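(* Let $(g,\mu,J)$ be a driven cofactor system in adapted coordinates $(y^i,x^a)$, with $J$ and $J_1$ nonsingular. In terms of the momenta $\tilde p$ defined by $p_i=J^j_i\tilde p_j$, $p_a=\tilde p_a+J^i_a\tilde p_i$, the quadratic integrals $H_{(i)}$ (for $i=1,\dots,n$) are given by $$H_{(i)}=\tfrac12A_{(i)}^{ab}\tilde p_a\tilde p_b+\tfrac12\Delta_{(i)}J_1^{kl}\tilde p_k\tilde p_l+W_{(i)},$$ where $$A_{(i)}^{ab}=\Delta_{(i+1)}g^{ab}+\sum_{j=1}^{n-i}(-1)^j\Delta_{(j+i+1)}(\bar J_2^{\,j})^{ab}.$$
   Context: Everything is smooth and the summation convention is used; coordinate domains are taken such that closed 1-forms are exact. Type $(1,1)$ tensors act on 1-forms by their adjoint; indices are raised with $g$. Special conformal Killing tensor (scKt) for a Riemannian metric $g$: a type $(1,1)$ tensor field $J$, symmetric with respect to $g$, with $J_{\alpha\beta|\gamma}=\frac12(\alpha_\alpha g_{\beta\gamma}+\alpha_\beta g_{\alpha\gamma})$, where $J_{\alpha\beta}=g_{\alpha\gamma}J^\gamma_\beta$, the bar is the Levi-Civita covariant derivative of $g$, and (necessarily) $\alpha=d(\operatorname{tr}J)$. The cofactor tensor $\operatorname{cof}J$ is defined by $J(\operatorname{cof}J)=(\operatorname{cof}J)J=(\det J)I$ (in general: the adjugate). $d_J$ is the degree 1 derivation of forms anticommuting with $d$ with $d_Jf=J(df)$, and $D_J\rho=d_J\rho+d(\operatorname{tr}J)\wedge\rho$. A cofactor system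 $(g,\mu,J)$ consists of a Riemannian metric $g$, a 1-form $\mu$ and a nonsingular scKt $J$ for $g$ with $D_J\mu=0$. Driven cofactor system in adapted coordinates: a cofactor system on a manifold of dimension $N=m+n$ with coordinates $(y^i,x^a)$, $i=1,\dots,m$, $a=1,\dots,n$, such that $g=g_{ij}(y)dy^i\otimes dy^j+g_{ab}(x)dx^a\otimes dx^b$ (no mixed terms) and $\mu=\mu_1+\mu_2$ with $\mu_1=Q_i(y)dy^i$, $\mu_2=Q_a(x,y)dx^a$, $Q_a=-\partial V/\partial x^a$ for a function $V(x,y)$, and the $\partial Q_a/\partial y^i$ are not all zero. $P_1,P_2$ are the complementary projectors onto $K^\perp=\mathrm{span}\{\partial/\partial y^i\}$ and $K=\mathrm{span}\{\partial/\partial x^a\}$; $J_1=P_1JP_1$ has components $J^i_j$, and its nonsingularity and inverse refer to its restriction to $K^\perp$. $\bar J_2$ has components $\bar J_2{}^a_b=J^a_b-J^a_i(J_1^{-1})^i_jJ^j_b$; $\bar J_2^{\,j}$ is its $j$-th power. Let $A(a)=\operatorname{cof}(J+aP_2)=\sum_{i=1}^{n+1}A_{(i)}a^{i-1}$ and $\det(J+aP_2)=\sum_{i=1}^{n+1}\Delta_{(i)}a^{i-1}$. Each $A_{(i)}\mu$ is closed; $W_{(i)}$ is defined (up to a constant) by $A_{(i)}\mu=-dW_{(i)}$, and $H_{(i)}=\frac12A_{(i)}^{\alpha\beta}p_\alpha p_\beta+W_{(i)}$, where $\alpha,\beta$ run over all $N$ coordinates and $p_i=g_{ij}\dot y^j$,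 $p_a=g_{ab}\dot x^b$. An empty sum (case $i=n$) is zero. *)

theory Defs
  imports "HOL-Analysis.Analysis" "HOL-Computational_Algebra.Polynomial"
begin

primrec Ck_on :: "nat \<Rightarrow> ('a::real_normed_vector \<Rightarrow> 'b::real_normed_vector) \<Rightarrow> 'a set \<Rightarrow> bool" where
  "Ck_on 0 f U \<longleftrightarrow> continuous_on U f"
| "Ck_on (Suc k) f U \<longleftrightarrow>
     (\<forall>x\<in>U. f differentiable (at x)) \<and> (\<forall>v. Ck_on k (\<lambda>x. frechet_derivative f (at x) v) U)"

definition smooth_on :: "'a::real_normed_vector set \<Rightarrow> ('a \<Rightarrow> 'b::real_normed_vector) \<Rightarrow> bool" where
  "smooth_on U f \<longleftrightarrow> (\<forall>k. Ck_on k f U)"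

definition pd :: "'k::finite \<Rightarrow> (real^'k \<Rightarrow> real) \<Rightarrow> real^'k \<Rightarrow> real" where
  "pd c f q = frechet_derivative f (at q) (axis c 1)"

text \<open>
  A 1-form has components \<open>\<omega>\<^sub>c = \<omega> q $ c\<close>. A 2-form is represented by its antisymmetric
  matrix of components, normalised so that \<open>dq\<^sup>c \<and> dq\<^sup>e\<close> has entry 1 at position \<open>(c,e)\<close>.
\<close>

definition ext_d0 :: "(real^'k::finite \<Rightarrow> real) \<Rightarrow> real^'k \<Rightarrow> real^'k" where
  "ext_d0 f q = (\<chi> c. pd c f q)"

definition ext_d1 :: "(real^'k::finite \<Rightarrow> real^'k) \<Rightarrow> real^'k \<Rightarrow> real^'k^'k" where
  "ext_d1 \<omega> q = (\<chi> c e. pd c (\<lambda>r. \<omega> r $ e) q - pd e (\<lambda>r. \<omega> r $ c) q)"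

definition wedge :: "real^'k::finite \<Rightarrow> real^'k \<Rightarrow> real^'k^'k" where
  "wedge \<omega> \<rho> = (\<chi> c e. \<omega> $ c * \<rho> $ e - \<omega> $ e * \<rho> $ c)"

definition coordinate_domain :: "(real^'k::finite) set \<Rightarrow> bool" where
  "coordinate_domain U \<longleftrightarrow> open U \<and>
     (\<forall>\<omega>. smooth_on U \<omega> \<and> (\<forall>q\<in>U. ext_d1 \<omega> q = 0) \<longrightarrow>
        (\<exists>f. smooth_on U f \<and> (\<forall>q\<in>U. \<omega> q = ext_d0 f q)))"

definition is_potential :: "(real^'k::finite) set \<Rightarrow> (real^'k \<Rightarrow> real^'k) \<Rightarrow> (real^'k \<Rightarrow> real) \<Rightarrow> bool" where
  "is_potential U \<omega> W \<longleftrightarrow> smooth_on U W \<and> (\<forall>q\<in>U. \<omega> q = - ext_d0 W q)"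

definition riemannian_metric :: "(real^'k::finite) set \<Rightarrow> (real^'k \<Rightarrow> real^'k^'k) \<Rightarrow> bool" where
  "riemannian_metric U g \<longleftrightarrow> smooth_on U g \<and>
     (\<forall>q\<in>U. transpose (g q) = g q \<and> (\<forall>v. v \<noteq> 0 \<longrightarrow> 0 < v \<bullet> (g q *v v)))"

definition christoffel :: "(real^'k::finite \<Rightarrow> real^'k^'k) \<Rightarrow> 'k \<Rightarrow> 'k \<Rightarrow> 'k \<Rightarrow> real^'k \<Rightarrow> real" where
  "christoffel g s a b q = (1/2) * (\<Sum>d\<in>UNIV. matrix_inv (g q) $ s $ d *
     (pd a (\<lambda>r. g r $ d $ b) q + pd b (\<lambda>r. g r $ d $ a) q - pd d (\<lambda>r. g r $ a $ b) q))"

text \<open>\<open>cov_deriv2 g T a b c\<close> is \<open>T\<^sub>a\<^sub>b\<^sub>|\<^sub>c\<close> for a tensor \<open>T\<close> of type (0,2).\<close>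

definition cov_deriv2 ::
  "(real^'k::finite \<Rightarrow> real^'k^'k) \<Rightarrow> (real^'k \<Rightarrow> real^'k^'k) \<Rightarrow> 'k \<Rightarrow> 'k \<Rightarrow> 'k \<Rightarrow> real^'k \<Rightarrow> real" where
  "cov_deriv2 g T a b c q = pd c (\<lambda>r. T r $ a $ b) q
     - (\<Sum>s\<in>UNIV. christoffel g s c a q * T q $ s $ b)
     - (\<Sum>s\<in>UNIV. christoffel g s c b q * T q $ a $ s)"

text \<open>
  A type (1,1) tensor \<open>J\<close> is the matrix with entry \<open>J q $ a $ b\<close> equal to \<open>J\<^sup>a\<^sub>b\<close> (upper index first).
  Hence it acts on vectors by \<open>J *v v\<close>, on 1-forms (adjoint action) by \<open>\<omega> v* J\<close>;
  lowering the upper index gives \<open>g ** J\<close>, and raising the lower index gives \<open>J ** matrix_inv g\<close>.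
\<close>

definition raise_index :: "real^'k::finite^'k \<Rightarrow> real^'k^'k \<Rightarrow> real^'k^'k" where
  "raise_index g T = T ** matrix_inv g"

definition scKt :: "(real^'k::finite) set \<Rightarrow> (real^'k \<Rightarrow> real^'k^'k) \<Rightarrow> (real^'k \<Rightarrow> real^'k^'k) \<Rightarrow> bool" where
  "scKt U g J \<longleftrightarrow> smooth_on U J \<and>
     (\<forall>q\<in>U. transpose (g q ** J q) = g q ** J q) \<and>
     (let \<alpha> = ext_d0 (\<lambda>r. trace (J r)) in
       \<forall>q\<in>U. \<forall>a b c. cov_deriv2 g (\<lambda>r. g r ** J r) a b c q =
         (1/2) * (\<alpha> q $ a * g q $ b $ c + \<alpha> q $ b * g q $ a $ c))"

text \<open>
  The derivation \<open>d\<^sub>J\<close> on functions and on 1-forms. Writing \<open>\<mu> = \<mu>\<^sub>b dq\<^sup>b\<close>, the derivation property gives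
  \<open>d\<^sub>J \<mu> = d\<^sub>J \<mu>\<^sub>b \<and> dq\<^sup>b + \<mu>\<^sub>b d\<^sub>J (dq\<^sup>b)\<close>, and anticommutation with \<open>d\<close> gives
  \<open>d\<^sub>J (dq\<^sup>b) = - d (d\<^sub>J q\<^sup>b) = - d (J dq\<^sup>b)\<close>. Here \<open>axis b 1\<close> is \<open>dq\<^sup>b\<close>.
\<close>

definition dJ0 :: "(real^'k::finite \<Rightarrow> real^'k^'k) \<Rightarrow> (real^'k \<Rightarrow> real) \<Rightarrow> real^'k \<Rightarrow> real^'k" where
  "dJ0 J f q = ext_d0 f q v* J q"

definition dJ1 :: "(real^'k::finite \<Rightarrow> real^'k^'k) \<Rightarrow> (real^'k \<Rightarrow> real^'k) \<Rightarrow> real^'k \<Rightarrow> real^'k^'k" where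
  "dJ1 J \<mu> q = (\<Sum>b\<in>UNIV. wedge (dJ0 J (\<lambda>r. \<mu> r $ b) q) (axis b 1)
                         - (\<mu> q $ b) *\<^sub>R ext_d1 (\<lambda>r. axis b 1 v* J r) q)"

definition DJ1 :: "(real^'k::finite \<Rightarrow> real^'k^'k) \<Rightarrow> (real^'k \<Rightarrow> real^'k) \<Rightarrow> real^'k \<Rightarrow> real^'k^'k" where
  "DJ1 J \<mu> q = dJ1 J \<mu> q + wedge (ext_d0 (\<lambda>r. trace (J r)) q) (\<mu> q)"

definition cofactor_system ::
  "(real^'k::finite) set \<Rightarrow> (real^'k \<Rightarrow> real^'k^'k) \<Rightarrow> (real^'k \<Rightarrow> real^'k) \<Rightarrow> (real^'k \<Rightarrow> real^'k^'k) \<Rightarrow> bool" where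
  "cofactor_system U g \<mu> J \<longleftrightarrow>
     riemannian_metric U g \<and> smooth_on U \<mu> \<and> scKt U g J \<and>
     (\<forall>q\<in>U. invertible (J q)) \<and> (\<forall>q\<in>U. DJ1 J \<mu> q = 0)"

text \<open>
  The coordinates \<open>(y\<^sup>i, x\<^sup>a)\<close> are the components of a point of \<open>real^('m + 'n)\<close>: \<open>y\<^sup>i = q $ Inl i\<close> and
  \<open>x\<^sup>a = q $ Inr a\<close>, so that \<open>m = CARD('m)\<close> and \<open>n = CARD('n)\<close>.
\<close>

definition y_part :: "'b^('m::finite + 'n::finite) \<Rightarrow> 'b^'m" where
  "y_part q = (\<chi> i. q $ Inl i)"

definition x_part :: "'b^('m::finite + 'n::finite) \<Rightarrow> 'b^'n" where
  "x_part q = (\<chi> a. q $ Inr a)"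

definition yy_block :: "'b^('m::finite + 'n::finite)^('m + 'n) \<Rightarrow> 'b^'m^'m" where
  "yy_block M = (\<chi> i j. M $ Inl i $ Inl j)"

definition xx_block :: "'b^('m::finite + 'n::finite)^('m + 'n) \<Rightarrow> 'b^'n^'n" where
  "xx_block M = (\<chi> a b. M $ Inr a $ Inr b)"

text \<open>The condition that not all \<open>\<partial>Q\<^sub>a/\<partial>y\<^sup>i\<close> vanish means that some of these functions is not identically zero.\<close>

definition driven_cofactor_system ::
  "(real^('m::finite + 'n::finite)) set \<Rightarrow> (real^('m + 'n) \<Rightarrow> real^('m + 'n)^('m + 'n)) \<Rightarrow>
   (real^('m + 'n) \<Rightarrow> real^('m + 'n)) \<Rightarrow> (real^('m + 'n) \<Rightarrow> real^('m + 'n)^('m + 'n)) \<Rightarrow> bool" where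
  "driven_cofactor_system U g \<mu> J \<longleftrightarrow>
     coordinate_domain U \<and> cofactor_system U g \<mu> J \<and>
     (\<forall>q\<in>U. \<forall>i a. g q $ Inl i $ Inr a = 0 \<and> g q $ Inr a $ Inl i = 0) \<and>
     (\<exists>g1. \<forall>q\<in>U. yy_block (g q) = g1 (y_part q)) \<and>
     (\<exists>g2. \<forall>q\<in>U. xx_block (g q) = g2 (x_part q)) \<and>
     (\<exists>Q1. \<forall>q\<in>U. y_part (\<mu> q) = Q1 (y_part q)) \<and>
     (\<exists>V. smooth_on U V \<and> (\<forall>q\<in>U. \<forall>a. \<mu> q $ Inr a = - pd (Inr a) V q)) \<and>
     (\<exists>q\<in>U. \<exists>a i. pd (Inl i) (\<lambda>r. \<mu> r $ Inr a) q \<noteq> 0)"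

definition P1 :: "real^('m::finite + 'n::finite)^('m + 'n)" where
  "P1 = (\<chi> \<alpha> \<beta>. if \<alpha> = \<beta> \<and> isl \<alpha> then 1 else 0)"

definition P2 :: "real^('m::finite + 'n::finite)^('m + 'n)" where
  "P2 = (\<chi> \<alpha> \<beta>. if \<alpha> = \<beta> \<and> \<not> isl \<alpha> then 1 else 0)"

definition J1 :: "real^('m::finite + 'n::finite)^('m + 'n) \<Rightarrow> real^('m + 'n)^('m + 'n)" where
  "J1 J = P1 ** J ** P1"

text \<open>The restriction of \<open>J1 J\<close> to the span of the \<open>\<partial>/\<partial>y\<^sup>i\<close> has matrix \<open>yy_block (J1 J)\<close>.\<close>

definition Jbar2 :: "real^('m::finite + 'n::finite)^('m + 'n) \<Rightarrow> real^'n^'n" where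
  "Jbar2 J = (\<chi> a b. J $ Inr a $ Inr b
     - (\<Sum>i\<in>UNIV. \<Sum>j\<in>UNIV. J $ Inr a $ Inl i * matrix_inv (yy_block (J1 J)) $ i $ j * J $ Inl j $ Inr b))"

text \<open>The operator \<open>^\<close> on vectors and matrices is not the matrix power (multiplication is componentwise).\<close>

primrec mat_power :: "real^'k::finite^'k \<Rightarrow> nat \<Rightarrow> real^'k^'k" where
  "mat_power M 0 = mat 1"
| "mat_power M (Suc j) = M ** mat_power M j"

text \<open>Entry \<open>(i,j)\<close> of the adjugate is the \<open>(j,i)\<close> cofactor: replace row \<open>j\<close> by the \<open>i\<close>-th unit vector.\<close>

definition cof :: "'b::comm_ring_1^'k::finite^'k \<Rightarrow> 'b^'k^'k" where
  "cof A = (\<chi> i j. det (\<chi> k. if k = j then axis i 1 else A $ k))"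

text \<open>
  \<open>J + a P2\<close> as a matrix of polynomials in \<open>a\<close>. The coefficients of its adjugate and determinant are indexed
  from 1: \<open>A_coeff J i\<close> and \<open>Delta_coeff J i\<close> belong to \<open>a ^ (i - 1)\<close>.
\<close>

definition pencil :: "real^('m::finite + 'n::finite)^('m + 'n) \<Rightarrow> real poly^('m + 'n)^('m + 'n)" where
  "pencil J = (\<chi> \<alpha> \<beta>. [: J $ \<alpha> $ \<beta>, P2 $ \<alpha> $ \<beta> :])"

definition A_coeff :: "real^('m::finite + 'n::finite)^('m + 'n) \<Rightarrow> nat \<Rightarrow> real^('m + 'n)^('m + 'n)" where
  "A_coeff J i = (\<chi> \<alpha> \<beta>. coeff (cof (pencil J) $ \<alpha> $ \<beta>) (i - 1))"

definition Delta_coeff :: "real^('m::finite + 'n::finite)^('m + 'n) \<Rightarrow> nat \<Rightarrow> real" where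
  "Delta_coeff J i = coeff (det (pencil J)) (i - 1)"

definition H_int ::
  "(real^('m::finite + 'n::finite) \<Rightarrow> real^('m + 'n)^('m + 'n)) \<Rightarrow> (real^('m + 'n) \<Rightarrow> real^('m + 'n)^('m + 'n)) \<Rightarrow>
   (nat \<Rightarrow> real^('m + 'n) \<Rightarrow> real) \<Rightarrow> nat \<Rightarrow> real^('m + 'n) \<Rightarrow> real^('m + 'n) \<Rightarrow> real" where
  "H_int g J W i q p =
     (1/2) * (\<Sum>\<alpha>\<in>UNIV. \<Sum>\<beta>\<in>UNIV. raise_index (g q) (A_coeff (J q) i) $ \<alpha> $ \<beta> * p $ \<alpha> * p $ \<beta>) + W i q"

lemma mat_mult_cof: "A ** cof A = mat (det A)" for A :: "'b::comm_ring_1^'k::finite^'k"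
proof -
  have "(A ** cof A) $ k $ j = mat (det A) $ k $ j" for k j
  proof -
    have *: "(\<Sum>i\<in>UNIV. A $ k $ i *s axis i 1) = A $ k"
      by (simp add: vec_eq_iff axis_def if_distrib cong: if_cong)
    have "(A ** cof A) $ k $ j = (\<Sum>i\<in>UNIV. det (\<chi> l. if l = j then A $ k $ i *s axis i 1 else A $ l))"
      by (simp add: matrix_matrix_mult_def cof_def
          det_row_mul[where a="\<lambda>l. axis _ 1" and b="\<lambda>l. A $ l"])
    also have "\<dots> = det (\<chi> l. if l = j then (\<Sum>i\<in>UNIV. A $ k $ i *s axis i 1) else A $ l)"
      using det_linear_row_sum[of UNIV j "\<lambda>l i. A $ k $ i *s axis i 1" "\<lambda>l. A $ l"] by simp
    also have "\<dots> = det (\<chi> l. if l = j then A $ k else A $ l)" by (simp only: *)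
    also have "\<dots> = mat (det A) $ k $ j"
    proof (cases "k = j")
      case True
      then have "(\<chi> l. if l = j then A $ k else A $ l) = A" by (simp add: vec_eq_iff)
      then show ?thesis using True by (simp add: mat_def)
    next
      case False
      have "det (\<chi> l. if l = j then A $ k else A $ l) = 0"
        by (rule det_identical_rows[OF False]) (simp add: row_def vec_eq_iff False)
      then show ?thesis using False by (simp add: mat_def)
    qed
    finally show ?thesis .
  qed
  then show ?thesis by (simp add: vec_eq_iff)
qed

lemma cof_transpose: "cof (transpose A) = transpose (cof A)" for A :: "'b::comm_ring_1^'k::finite^'k"
proof -
  have "det (\<chi> k. if k = j then axis i 1 else transpose A $ k) = det (\<chi> k. if k = i then axis j 1 else A $ k)"
    for i j
  proof -
    have "det (\<chi> k. if k = j then axis i 1 else transpose A $ k) =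
          det (transpose (\<chi> k. if k = j then axis i 1 else transpose A $ k))" by simp
    also have "\<dots> = det (\<chi> k. if k = i then axis j 1 else A $ k)"
      unfolding det_def
    proof (rule sum.cong[OF refl])
      fix p :: "'k \<Rightarrow> 'k" assume "p \<in> {p. p permutes UNIV}"
      then have inj: "p x = p y \<longleftrightarrow> x = y" and surj: "\<exists>x. p x = j" for x y
        by (auto simp: permutes_inj inj_eq dest: permutes_surj) (metis permutes_surj surjD)
      let ?L = "\<lambda>k. transpose (\<chi> k. if k = j then axis i 1 else transpose A $ k) $ k $ p k"
      let ?R = "\<lambda>k. (\<chi> k. if k = i then axis j 1 else A $ k) $ k $ p k"
      have "prod ?L UNIV = prod ?R UNIV"
      proof (cases "p i = j")
        case True
        then have "?L k = ?R k" for k using inj[of k i] by (auto simp: transpose_def axis_def)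
        then show ?thesis by simp
      next
        case False
        obtain k where k: "p k = j" using surj by blast
        have "?L k = 0" using k False by (auto simp: transpose_def axis_def)
        moreover have "?R i = 0" using False by (auto simp: axis_def)
        ultimately show ?thesis by (metis (no_types, lifting) finite UNIV_I prod_zero)
      qed
      then show "of_int (sign p) * prod ?L UNIV = of_int (sign p) * prod ?R UNIV" by simp
    qed
    finally show ?thesis .
  qed
  then have "cof (transpose A) $ i $ j = cof A $ j $ i" for i j by (simp add: cof_def)
  then show ?thesis by (simp add: transpose_def[of "cof A"] vec_eq_iff)
qed

lemma cof_mult_mat: "cof A ** A = mat (det A)" for A :: "'b::comm_ring_1^'k::finite^'k"
proof -
  have "transpose (cof A ** A) = transpose (mat (det A))"
    by (simp add: matrix_transpose_mul cof_transpose[symmetric] mat_mult_cof transpose_mat)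
  then show ?thesis by (metis transpose_transpose)
qed

lemma poly_det: "poly (det M) a = det (\<chi> i j. poly (M $ i $ j) a)" for M :: "real poly^'k::finite^'k"
proof -
  have "poly (of_int z) a = of_int z" for z :: int by (simp add: of_int_poly)
  then show ?thesis by (simp add: det_def poly_sum poly_prod)
qed

lemma degree_det_le:
  fixes M :: "real poly^('m::finite + 'n::finite)^('m + 'n)"
  assumes "\<And>\<alpha> \<beta>. degree (M $ \<alpha> $ \<beta>) \<le> (if isl \<alpha> then 0 else 1)"
  shows "degree (det M) \<le> CARD('n)"
  unfolding det_def
proof (rule degree_sum_le)
  fix p :: "'m + 'n \<Rightarrow> 'm + 'n"
  have "degree (\<Prod>i\<in>UNIV. M $ i $ p i) \<le> (\<Sum>i\<in>UNIV. degree (M $ i $ p i))"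
    using degree_prod_sum_le[of UNIV "\<lambda>i. M $ i $ p i"] by (simp add: o_def)
  also have "\<dots> \<le> (\<Sum>i\<in>(UNIV :: ('m + 'n) set). if isl i then 0 else 1)" by (rule sum_mono) (rule assms)
  also have "\<dots> = CARD('n)"
  proof -
    have "(\<Sum>i\<in>(UNIV :: ('m + 'n) set). if isl i then 0 else 1 :: nat) = (\<Sum>i\<in>range (Inr :: 'n \<Rightarrow> 'm + 'n). 1)"
      by (rule sum.mono_neutral_cong_right) (auto simp: isl_def elim: sumE, metis rangeI sumE)
    also have "\<dots> = CARD('n)" by (simp add: card_image)
    finally show ?thesis .
  qed
  finally have d: "degree (\<Prod>i\<in>UNIV. M $ i $ p i) \<le> CARD('n)" .
  have "degree (of_int (sign p) * (\<Prod>i\<in>UNIV. M $ i $ p i)) \<le>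
        degree (of_int (sign p) :: real poly) + degree (\<Prod>i\<in>UNIV. M $ i $ p i)"
    by (rule degree_mult_le)
  then show "degree (of_int (sign p) * (\<Prod>i\<in>UNIV. M $ i $ p i)) \<le> CARD('n)"
    using d by simp
qed simp

lemma poly_eq_sum_from_1:
  fixes p :: "real poly"
  assumes "degree p \<le> N"
  shows "poly p a = (\<Sum>i = 1..N + 1. coeff p (i - 1) * a ^ (i - 1))"
proof -
  have "poly p a = (\<Sum>i\<le>N. coeff p i * a ^ i)"
    unfolding poly_altdef
    by (rule sum.mono_neutral_left) (use assms in \<open>auto simp: coeff_eq_0\<close>)
  also have "\<dots> = (\<Sum>i = 1..N + 1. coeff p (i - 1) * a ^ (i - 1))"
    by (rule sum.reindex_bij_witness[of _ "\<lambda>i. i - 1" Suc]) auto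
  finally show ?thesis .
qed

lemma det_pencil_expansion:
  fixes J :: "real^('m::finite + 'n::finite)^('m + 'n)"
  shows "det (J + a *\<^sub>R P2) = (\<Sum>i = 1..CARD('n) + 1. Delta_coeff J i * a ^ (i - 1))"
proof -
  have "degree (det (pencil J)) \<le> CARD('n)"
    by (rule degree_det_le) (auto simp: pencil_def P2_def)
  then have "poly (det (pencil J)) a = (\<Sum>i = 1..CARD('n) + 1. Delta_coeff J i * a ^ (i - 1))"
    unfolding Delta_coeff_def by (rule poly_eq_sum_from_1)
  moreover have "(\<chi> i j. poly (pencil J $ i $ j) a) = J + a *\<^sub>R P2"
    by (simp add: pencil_def vec_eq_iff)
  ultimately show ?thesis by (simp add: poly_det)
qed

lemma cof_pencil_expansion:
  fixes J :: "real^('m::finite + 'n::finite)^('m + 'n)"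
  shows "cof (J + a *\<^sub>R P2) = (\<Sum>i = 1..CARD('n) + 1. (a ^ (i - 1)) *\<^sub>R A_coeff J i)"
proof -
  have "cof (J + a *\<^sub>R P2) $ \<alpha> $ \<beta> = (\<Sum>i = 1..CARD('n) + 1. A_coeff J i $ \<alpha> $ \<beta> * a ^ (i - 1))" for \<alpha> \<beta>
  proof -
    have "degree (cof (pencil J) $ \<alpha> $ \<beta>) \<le> CARD('n)"
      unfolding cof_def by (simp, rule degree_det_le) (auto simp: pencil_def P2_def axis_def)
    then have "poly (cof (pencil J) $ \<alpha> $ \<beta>) a = (\<Sum>i = 1..CARD('n) + 1. A_coeff J i $ \<alpha> $ \<beta> * a ^ (i - 1))"
      unfolding A_coeff_def by (simp only: vec_lambda_beta) (rule poly_eq_sum_from_1)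
    moreover have "(\<chi> i j. poly ((\<chi> k. if k = \<beta> then axis \<alpha> 1 else pencil J $ k) $ i $ j) a)
        = (\<chi> k. if k = \<beta> then axis \<alpha> 1 else (J + a *\<^sub>R P2) $ k)"
      by (auto simp: pencil_def vec_eq_iff axis_def)
    ultimately show ?thesis by (simp add: cof_def poly_det)
  qed
  then show ?thesis by (simp add: vec_eq_iff sum_component mult.commute)
qed

end

theory Submission
  imports Defs
begin

text \<open>
  Everything happens at one point. Comparing coefficients of \<open>a\<close> in
  \<open>(J + a P\<^sub>2) A(a) = A(a) (J + a P\<^sub>2) = det (J + a P\<^sub>2) I\<close> and multiplying by \<open>P\<^sub>1\<close>, which kills \<open>P\<^sub>2\<close>,
  gives \<open>P\<^sub>1 J A\<^sub>i = \<Delta>\<^sub>i P\<^sub>1\<close> and \<open>A\<^sub>i J P\<^sub>1 = \<Delta>\<^sub>i P\<^sub>1\<close>.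
  The change of momenta is \<open>p = p' L\<close> with \<open>L = P\<^sub>1 J + P\<^sub>2\<close>, and the two identities block-diagonalise
  \<open>L A\<^sub>i g\<^sup>-\<^sup>1 L\<^sup>T\<close>. Eliminating the \<open>y\<close> columns of \<open>J\<close> by a Gauss step turns the first product into
  \<open>(S + a) X(a) = det (J + a P\<^sub>2) I\<close>, where \<open>S\<close> is the Schur complement \<open>Jbar2 J\<close> and \<open>X(a)\<close> the
  \<open>x\<close>-block of \<open>A(a)\<close>. This is a recursion for the coefficients of \<open>X\<close>, solved downwards from
  degree \<open>n\<close>, where they vanish.
\<close>

section \<open>Block sums and matrix algebra\<close>

lemma sum_UNIV_sum:
  fixes f :: "'m::finite + 'n::finite \<Rightarrow> 'b::comm_monoid_add"
  shows "sum f UNIV = (\<Sum>i\<in>UNIV. f (Inl i)) + (\<Sum>a\<in>UNIV. f (Inr a))"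
  by (simp add: sum.Plus flip: UNIV_Plus_UNIV)

lemma mat_mult_left: "mat c ** M = c *\<^sub>R M" for M :: "real^'k::finite^'l::finite"
  by (simp add: vec_eq_iff matrix_matrix_mult_def mat_def if_distrib if_distribR sum.delta cong: if_cong)

lemma mat_mult_right: "M ** mat c = c *\<^sub>R M" for M :: "real^'k::finite^'l::finite"
  by (simp add: vec_eq_iff matrix_matrix_mult_def mat_def if_distrib if_distribR sum.delta' mult.commute cong: if_cong)

lemma matrix_add_rdistrib: "(A + B) ** C = A ** C + B ** C"
  by (simp add: vec_eq_iff matrix_matrix_mult_def sum.distrib algebra_simps)

lemma
  fixes A :: "real^'k::finite^'k"
  assumes "invertible A"
  shows matrix_inv_left: "matrix_inv A ** A = mat 1" and matrix_inv_right: "A ** matrix_inv A = mat 1"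
proof -
  have "\<exists>B. A ** B = mat 1 \<and> B ** A = mat 1" using assms by (simp add: invertible_def)
  from someI_ex[OF this] show "matrix_inv A ** A = mat 1" "A ** matrix_inv A = mat 1"
    by (simp_all add: matrix_inv_def)
qed

section \<open>Coefficients of the cofactor identities, and the projectors\<close>

lemma coeff_linear_mult: "coeff ([:b, c:] * p) k = b * coeff p k + (if k = 0 then 0 else c * coeff p (k - 1))"
  for p :: "'b::comm_ring_1 poly"
  by (cases k) simp_all

lemma coeff_mult_linear: "coeff (p * [:b, c:]) k = coeff p k * b + (if k = 0 then 0 else coeff p (k - 1) * c)"
  for p :: "'b::comm_ring_1 poly"
  using coeff_linear_mult[of b c p k] by (simp add: mult.commute del: mult_pCons_left mult_pCons_right)

lemma pencil_mult_coeff: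
  "(\<chi> \<alpha> \<beta>. coeff ((pencil J ** M) $ \<alpha> $ \<beta>) k) =
     J ** (\<chi> \<alpha> \<beta>. coeff (M $ \<alpha> $ \<beta>) k) +
     (if k = 0 then 0 else P2 ** (\<chi> \<alpha> \<beta>. coeff (M $ \<alpha> $ \<beta>) (k - 1)))"
  unfolding matrix_matrix_mult_def pencil_def
  by (simp add: vec_eq_iff coeff_sum coeff_linear_mult sum.distrib del: mult_pCons_left mult_pCons_right)

lemma mult_pencil_coeff:
  "(\<chi> \<alpha> \<beta>. coeff ((M ** pencil J) $ \<alpha> $ \<beta>) k) =
     (\<chi> \<alpha> \<beta>. coeff (M $ \<alpha> $ \<beta>) k) ** J +
     (if k = 0 then 0 else (\<chi> \<alpha> \<beta>. coeff (M $ \<alpha> $ \<beta>) (k - 1)) ** P2)"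
  unfolding matrix_matrix_mult_def pencil_def
  by (simp add: vec_eq_iff coeff_sum coeff_mult_linear sum.distrib del: mult_pCons_left mult_pCons_right)

lemma coeff_mat: "(\<chi> \<alpha> \<beta>. coeff ((mat d :: 'b::comm_ring_1 poly^'k::finite^'k) $ \<alpha> $ \<beta>) k) = mat (coeff d k)"
  by (simp add: vec_eq_iff mat_def)

text \<open>Index \<open>Suc k\<close> belongs to the power k of a. The case k = 0 is split off
  because index 0 would, by truncated subtraction, name the constant coefficient again instead of
  zero.\<close>

lemma J_mult_A_coeff:
  "J ** A_coeff J (Suc k) + (if k = 0 then 0 else P2 ** A_coeff J k) = mat (Delta_coeff J (Suc k))"
  using pencil_mult_coeff[of J "cof (pencil J)" k]
  by (simp add: mat_mult_cof coeff_mat A_coeff_def Delta_coeff_def)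

lemma A_coeff_mult_J:
  "A_coeff J (Suc k) ** J + (if k = 0 then 0 else A_coeff J k ** P2) = mat (Delta_coeff J (Suc k))"
  using mult_pencil_coeff[of "cof (pencil J)" J k]
  by (simp add: cof_mult_mat coeff_mat A_coeff_def Delta_coeff_def)

text \<open>Each projector acts as a mask: multiplication on the right blanks columns, on the left
  it blanks rows. Later block computations are reduced to entries with these rules.\<close>

lemma projector_mult_nth:
  shows "(M ** P1) $ \<alpha> $ \<beta> = (if isl \<beta> then M $ \<alpha> $ \<beta> else 0)"
    and "(M ** P2) $ \<alpha> $ \<beta> = (if isl \<beta> then 0 else M $ \<alpha> $ \<beta>)"
    and "(P1 ** N) $ \<beta> $ \<alpha> = (if isl \<beta> then N $ \<beta> $ \<alpha> else 0)"
    and "(P2 ** N) $ \<beta> $ \<alpha> = (if isl \<beta> then 0 else N $ \<beta> $ \<alpha>)"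
    and "(v v* P2) $ \<beta> = (if isl \<beta> then 0 else v $ \<beta>)"
proof -
  have if_mult: "x * (if c then 1 else 0) = (if c then x else 0)" "(if c then 1 else 0) * x = (if c then x else 0)"
    for x :: real and c by simp_all
  have delta: "(\<Sum>\<gamma>\<in>UNIV. if \<gamma> = \<beta> \<and> b \<gamma> then f \<gamma> else 0) = (if b \<beta> then f \<beta> else 0)"
    "(\<Sum>\<gamma>\<in>UNIV. if \<beta> = \<gamma> \<and> b \<beta> then f \<gamma> else 0) = (if b \<beta> then f \<beta> else 0)"
    for f :: "'k::finite \<Rightarrow> real" and b \<beta>
  proof -
    have "(\<Sum>\<gamma>\<in>UNIV. if \<gamma> = \<beta> \<and> b \<gamma> then f \<gamma> else 0) = (\<Sum>\<gamma>\<in>UNIV. if \<gamma> = \<beta> then if b \<beta> then f \<beta> else 0 else 0)"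
      "(\<Sum>\<gamma>\<in>UNIV. if \<beta> = \<gamma> \<and> b \<beta> then f \<gamma> else 0) = (\<Sum>\<gamma>\<in>UNIV. if \<gamma> = \<beta> then if b \<beta> then f \<beta> else 0 else 0)"
      by (intro sum.cong refl; auto)+
    then show "(\<Sum>\<gamma>\<in>UNIV. if \<gamma> = \<beta> \<and> b \<gamma> then f \<gamma> else 0) = (if b \<beta> then f \<beta> else 0)"
      "(\<Sum>\<gamma>\<in>UNIV. if \<beta> = \<gamma> \<and> b \<beta> then f \<gamma> else 0) = (if b \<beta> then f \<beta> else 0)"
      by simp_all
  qed
  show "(M ** P1) $ \<alpha> $ \<beta> = (if isl \<beta> then M $ \<alpha> $ \<beta> else 0)"
    and "(M ** P2) $ \<alpha> $ \<beta> = (if isl \<beta> then 0 else M $ \<alpha> $ \<beta>)"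
    and "(P1 ** N) $ \<beta> $ \<alpha> = (if isl \<beta> then N $ \<beta> $ \<alpha> else 0)"
    and "(P2 ** N) $ \<beta> $ \<alpha> = (if isl \<beta> then 0 else N $ \<beta> $ \<alpha>)"
    and "(v v* P2) $ \<beta> = (if isl \<beta> then 0 else v $ \<beta>)"
    by (simp_all add: matrix_matrix_mult_def vector_matrix_mult_def P1_def P2_def if_mult delta)
qed

lemma P1_P2: "P1 ** P2 = 0" "P2 ** P1 = 0" "P1 + P2 = mat 1" "P1 ** P1 = P1"
  "transpose P1 = P1" "transpose P2 = P2"
  by (auto simp: vec_eq_iff projector_mult_nth) (auto simp: P1_def P2_def mat_def transpose_def)

lemma P1_J_A_coeff: "P1 ** (J ** A_coeff J (Suc k)) = Delta_coeff J (Suc k) *\<^sub>R P1"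
  using arg_cong[OF J_mult_A_coeff[of J k], of "\<lambda>M. P1 ** M"]
  by (simp add: matrix_add_ldistrib matrix_mul_assoc P1_P2 mat_mult_right split: if_splits)

lemma A_coeff_J_P1: "A_coeff J (Suc k) ** (J ** P1) = Delta_coeff J (Suc k) *\<^sub>R P1"
  using arg_cong[OF A_coeff_mult_J[of J k], of "\<lambda>M. M ** P1"]
  by (simp add: matrix_add_rdistrib P1_P2 mat_mult_left flip: matrix_mul_assoc split: if_splits)

section \<open>The Schur complement and the x-block of the cofactor coefficients\<close>

lemma xx_block_A_coeff_recursion:
  fixes J :: "real^('m::finite + 'n::finite)^('m + 'n)"
  assumes "invertible (yy_block (J1 J))"
  shows "Jbar2 J ** xx_block (A_coeff J (Suc (Suc k))) + xx_block (A_coeff J (Suc k))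
    = mat (Delta_coeff J (Suc (Suc k)))"
proof -
  define K where "K = matrix_inv (yy_block (J1 J))"
  \<comment> \<open>\<open>R\<close> is the block row consisting of -J_xy \<open>K\<close> and the
    identity, where J_xy has x rows and y columns. It subtracts multiples of the y rows from the x
    rows so that the y columns of \<open>J\<close> cancel, because \<open>K\<close> inverts the
    y-block; the x columns become \<open>Jbar2 J\<close>. Since \<open>P2\<close> vanishes on the y
    rows, this elimination leaves the coefficient of a undisturbed.\<close>
  define R :: "real^('m + 'n)^'n" where
    "R = (\<chi> a \<gamma>. case \<gamma> of Inl j \<Rightarrow> - (\<Sum>i\<in>UNIV. J $ Inr a $ Inl i * K $ i $ j)
                         | Inr b \<Rightarrow> if a = b then 1 else 0)"
  \<comment> \<open>\<open>E\<close> is the block row (0, identity): conjugation by it extracts the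
    x-block, and \<open>R ** J\<close> and \<open>R ** P2\<close> both factor through it.\<close>
  define E :: "real^('m + 'n)^'n" where "E = (\<chi> a \<gamma>. if \<gamma> = Inr a then 1 else 0)"
  have "yy_block (J1 J) = (\<chi> i j. J $ Inl i $ Inl j)"
    by (simp add: yy_block_def J1_def projector_mult_nth vec_eq_iff)
  moreover have "K ** yy_block (J1 J) = mat 1"
    unfolding K_def using assms by (rule matrix_inv_left)
  ultimately have K: "(\<Sum>j\<in>UNIV. K $ i $ j * J $ Inl j $ Inl k) = (if i = k then 1 else 0)" for i k
    by (simp add: matrix_matrix_mult_def vec_eq_iff mat_def)
  have "(\<Sum>j\<in>UNIV. (\<Sum>i\<in>UNIV. J $ Inr a $ Inl i * K $ i $ j) * J $ Inl j $ Inl k) = J $ Inr a $ Inl k"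
    for a k
  proof -
    have "(\<Sum>j\<in>UNIV. (\<Sum>i\<in>UNIV. J $ Inr a $ Inl i * K $ i $ j) * J $ Inl j $ Inl k)
        = (\<Sum>i\<in>UNIV. J $ Inr a $ Inl i * (\<Sum>j\<in>UNIV. K $ i $ j * J $ Inl j $ Inl k))"
      unfolding sum_distrib_left sum_distrib_right by (subst sum.swap) (simp add: mult.assoc)
    then show ?thesis by (simp add: K if_distrib cong: if_cong)
  qed
  moreover have "(\<Sum>j\<in>UNIV. (\<Sum>i\<in>UNIV. J $ Inr a $ Inl i * K $ i $ j) * J $ Inl j $ Inr b)
      = (\<Sum>i\<in>UNIV. \<Sum>j\<in>UNIV. J $ Inr a $ Inl i * K $ i $ j * J $ Inl j $ Inr b)" for a b
    unfolding sum_distrib_right by (rule sum.swap)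
  ultimately have "(R ** J) $ a $ \<gamma> = (Jbar2 J ** E) $ a $ \<gamma>" for a \<gamma>
    by (cases \<gamma>) (simp_all add: R_def E_def Jbar2_def K_def matrix_matrix_mult_def sum_UNIV_sum
        sum_negf if_distrib if_distribR cong: if_cong)
  then have RJ: "R ** J = Jbar2 J ** E" by (simp add: vec_eq_iff)
  have RP: "R ** P2 = E"
  proof -
    have "(R ** P2) $ a $ \<gamma> = E $ a $ \<gamma>" for a \<gamma>
      by (cases \<gamma>) (simp_all add: projector_mult_nth R_def E_def)
    then show ?thesis by (simp add: vec_eq_iff)
  qed
  have mult_E: "(M ** transpose E) $ a $ b = M $ a $ Inr b" for M :: "real^('m + 'n)^'n" and a b
    unfolding matrix_matrix_mult_def E_def transpose_def
    using sum.delta[of UNIV "Inr b" "\<lambda>\<gamma>. M $ a $ \<gamma>"] by (simp add: if_distrib[of "times _"] cong: if_cong)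
  have E_mult: "(E ** N) $ a $ \<beta> = N $ Inr a $ \<beta>" for N :: "real^('m + 'n)^('m + 'n)" and a \<beta>
    unfolding matrix_matrix_mult_def E_def
    using sum.delta[of UNIV "Inr a" "\<lambda>\<gamma>. N $ \<gamma> $ \<beta>"] by (simp add: if_distrib[of "\<lambda>x. x * _"] cong: if_cong)
  have RE: "R ** transpose E = mat 1"
    by (simp add: mult_E R_def mat_def vec_eq_iff)
  have xx: "xx_block M = E ** M ** transpose E" for M
    by (simp add: mult_E E_mult xx_block_def vec_eq_iff)
  have "R ** (J ** A_coeff J (Suc (Suc k)) + P2 ** A_coeff J (Suc k)) ** transpose E
      = R ** mat (Delta_coeff J (Suc (Suc k))) ** transpose E"
    using J_mult_A_coeff[of J "Suc k"] by simp
  then have "R ** J ** A_coeff J (Suc (Suc k)) ** transpose E + R ** P2 ** A_coeff J (Suc k) ** transpose E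
      = Delta_coeff J (Suc (Suc k)) *\<^sub>R (R ** transpose E)"
    by (simp add: matrix_add_ldistrib matrix_add_rdistrib matrix_mul_assoc mat_mult_right scalar_matrix_assoc)
  then show ?thesis
    by (simp add: RJ RP RE xx matrix_mul_assoc flip: mat_mult_left)
qed

text \<open>The y rows of the pencil are constant, the x rows at most linear, and the row replaced
  in a cofactor becomes constant. Hence every product in the determinant has degree at most
  n.\<close>

lemma degree_cof_pencil_le:
  fixes J :: "real^('m::finite + 'n::finite)^('m + 'n)"
  shows "degree (cof (pencil J) $ \<alpha> $ \<beta>) \<le> CARD('n)"
  unfolding cof_def by (simp, rule degree_det_le) (auto simp: pencil_def P2_def axis_def)

text \<open>Each downward step of the recursion multiplies the previous sum by
  -\<open>Jbar2 J\<close>, which produces the powers and the alternating signs.\<close>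

lemma xx_block_A_coeff:
  fixes J :: "real^('m::finite + 'n::finite)^('m + 'n)"
  assumes inv: "invertible (yy_block (J1 J))" and "k < CARD('n)"
  shows "xx_block (A_coeff J (Suc k)) =
    (\<Sum>j\<le>CARD('n) - Suc k. ((- 1) ^ j * Delta_coeff J (j + k + 2)) *\<^sub>R mat_power (Jbar2 J) j)"
proof -
  have rec: "xx_block (A_coeff J (Suc k)) = mat (Delta_coeff J (Suc (Suc k)))
      - Jbar2 J ** xx_block (A_coeff J (Suc (Suc k)))" for k
    using xx_block_A_coeff_recursion[OF inv, of k] by (simp add: eq_diff_eq add.commute)
  \<comment> \<open>The degree bound only removes index n + 2. One use of the recursion then shows
    that at index n + 1 the x-block vanishes, although the full matrix does not in general.\<close>
  have top: "xx_block (A_coeff J (Suc CARD('n))) = 0"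
  proof -
    have "A_coeff J (Suc (Suc CARD('n))) = 0"
      using degree_cof_pencil_le[of J]
      by (simp add: A_coeff_def vec_eq_iff coeff_eq_0 less_Suc_eq_le)
    moreover have "degree (det (pencil J)) \<le> CARD('n)"
      by (rule degree_det_le) (auto simp: pencil_def P2_def)
    then have "Delta_coeff J (Suc (Suc CARD('n))) = 0"
      by (simp add: Delta_coeff_def coeff_eq_0 less_Suc_eq_le)
    ultimately show ?thesis
      by (subst rec) (simp add: xx_block_def matrix_matrix_mult_def mat_def vec_eq_iff)
  qed
  \<comment> \<open>The strict bound j < n - k lets the induction start at k = n with an empty sum;
    the bound j \<le> n - \<open>Suc k\<close> would leave a term there by truncated
    subtraction.\<close>
  have "xx_block (A_coeff J (Suc k)) =
    (\<Sum>j<CARD('n) - k. ((- 1) ^ j * Delta_coeff J (j + k + 2)) *\<^sub>R mat_power (Jbar2 J) j)"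
    if "k \<le> CARD('n)" for k
    using that
  proof (induction k rule: inc_induct)
    case base
    show ?case by (simp add: top)
  next
    case (step k)
    have s: "CARD('n) - k = Suc (CARD('n) - Suc k)" using step.hyps by simp
    have "Jbar2 J ** (\<Sum>j\<in>S. c j *\<^sub>R M j) = (\<Sum>j\<in>S. c j *\<^sub>R (Jbar2 J ** M j))"
      for S :: "nat set" and c M
      by (induction S rule: infinite_finite_induct)
         (simp_all add: matrix_add_ldistrib matrix_scalar_ac flip: scalar_matrix_assoc)
    then have "Jbar2 J ** xx_block (A_coeff J (Suc (Suc k))) =
        (\<Sum>j<CARD('n) - Suc k. ((- 1) ^ j * Delta_coeff J (j + Suc k + 2)) *\<^sub>R mat_power (Jbar2 J) (Suc j))"
      by (simp only: step.IH mat_power.simps)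
    moreover have "mat (Delta_coeff J (Suc (Suc k))) = Delta_coeff J (Suc (Suc k)) *\<^sub>R mat_power (Jbar2 J) 0"
      using mat_mult_left[of "Delta_coeff J (Suc (Suc k))" "mat 1 :: real^'n^'n"] by simp
    ultimately show ?case
      unfolding s sum.lessThan_Suc_shift by (subst rec) (simp add: sum_negf del: mat_power.simps)
  qed
  then show ?thesis using assms by (simp add: lessThan_Suc_atMost Suc_diff_Suc flip: lessThan_Suc_atMost)
qed

section \<open>The inverse metric and the change of momenta\<close>

lemma invertible_positive_definite:
  fixes g :: "real^'k::finite^'k"
  assumes "\<And>v. v \<noteq> 0 \<Longrightarrow> 0 < v \<bullet> (g *v v)"
  shows "invertible g"
  unfolding invertible_left_inverse matrix_left_invertible_ker
  using assms by (metis inner_zero_right less_irrefl)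

text \<open>Here \<open>G\<close> stands for the inverse metric. The left factor is absorbed by
  \<open>P1_J_A_coeff\<close>. On the right, \<open>GJ\<close> and \<open>GP\<close> carry
  \<open>transpose J ** P1\<close> across \<open>G\<close>, where it becomes \<open>J ** P1\<close>
  next to the cofactor coefficient and \<open>A_coeff_J_P1\<close> applies. Both mixed terms then
  contain a vanishing product of \<open>P1\<close> and \<open>P2\<close>.\<close>

lemma momentum_change_block_diagonal:
  assumes GJ: "G ** transpose J = J ** G" and GP: "G ** P1 = P1 ** G"
  shows "(P1 ** J + P2) ** (A_coeff J (Suc k) ** G) ** transpose (P1 ** J + P2)
    = Delta_coeff J (Suc k) *\<^sub>R (P1 ** J ** P1 ** G) + P2 ** (A_coeff J (Suc k) ** G) ** P2"
proof -
  define A where "A = A_coeff J (Suc k)"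
  define d where "d = Delta_coeff J (Suc k)"
  have "(P1 ** J + P2) ** (A ** G) = d *\<^sub>R (P1 ** G) + P2 ** A ** G"
    using P1_J_A_coeff[of J k]
    by (simp add: A_def d_def matrix_add_rdistrib matrix_mul_assoc flip: scalar_matrix_assoc)
  moreover have "transpose (P1 ** J + P2) = transpose J ** P1 + P2"
  proof -
    have "transpose (P1 ** J + P2) = transpose (P1 ** J) + transpose P2"
      by (simp add: transpose_def vec_eq_iff)
    then show ?thesis by (simp add: matrix_transpose_mul P1_P2)
  qed
  moreover have "P1 ** G ** (transpose J ** P1) = P1 ** J ** P1 ** G"
  proof -
    have "P1 ** G ** (transpose J ** P1) = P1 ** (G ** transpose J) ** P1" by (simp only: matrix_mul_assoc)
    also have "\<dots> = P1 ** J ** (G ** P1)" by (simp only: GJ matrix_mul_assoc)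
    finally show ?thesis by (simp only: GP matrix_mul_assoc)
  qed
  moreover have "P1 ** G ** P2 = 0"
    by (simp add: P1_P2 flip: GP matrix_mul_assoc)
  moreover have "P2 ** A ** G ** (transpose J ** P1) = 0"
  proof -
    have "P2 ** A ** G ** (transpose J ** P1) = P2 ** (A ** (J ** P1)) ** G"
    proof -
      have "P2 ** A ** G ** (transpose J ** P1) = P2 ** A ** (G ** transpose J) ** P1"
        by (simp only: matrix_mul_assoc)
      also have "\<dots> = P2 ** A ** J ** (G ** P1)" by (simp only: GJ matrix_mul_assoc)
      finally show ?thesis by (simp only: GP matrix_mul_assoc)
    qed
    also have "\<dots> = 0"
      using A_coeff_J_P1[of J k] by (simp add: A_def matrix_scalar_ac P1_P2 flip: scalar_matrix_assoc)
    finally show ?thesis .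
  qed
  ultimately show ?thesis
    by (simp add: A_def d_def matrix_add_ldistrib matrix_add_rdistrib matrix_mul_assoc flip: scalar_matrix_assoc)
qed

lemma quadratic_form_eq_inner:
  "(\<Sum>\<alpha>\<in>UNIV. \<Sum>\<beta>\<in>UNIV. M $ \<alpha> $ \<beta> * v $ \<alpha> * v $ \<beta>) = v \<bullet> (M *v v)" for M :: "real^'k::finite^'k"
  by (simp add: inner_vec_def matrix_vector_mult_def sum_distrib_left mult_ac)

lemma quadratic_form_vector_matrix_mult:
  "(v v* L) \<bullet> (M *v (v v* L)) = v \<bullet> ((L ** M ** transpose L) *v v)" for M :: "real^'k::finite^'k"
  by (simp add: dot_lmul_matrix flip: matrix_vector_mul_assoc)

theorem proposition7:
  fixes U :: "(real^('m::finite + 'n::finite)) set"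
    and g J :: "real^('m + 'n) \<Rightarrow> real^('m + 'n)^('m + 'n)"
    and \<mu> :: "real^('m + 'n) \<Rightarrow> real^('m + 'n)"
    and W :: "nat \<Rightarrow> real^('m + 'n) \<Rightarrow> real"
    and i :: nat
    and q p p' :: "real^('m + 'n)"
  assumes "driven_cofactor_system U g \<mu> J"
    and "\<forall>r\<in>U. invertible (yy_block (J1 (J r)))"
    and "i \<in> {1..CARD('n)}"
    and "is_potential U (\<lambda>r. \<mu> r v* A_coeff (J r) i) (W i)"
    and "q \<in> U"
    and "\<forall>k. p $ Inl k = (\<Sum>j\<in>UNIV. J q $ Inl j $ Inl k * p' $ Inl j)"
    and "\<forall>a. p $ Inr a = p' $ Inr a + (\<Sum>k\<in>UNIV. J q $ Inl k $ Inr a * p' $ Inl k)"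
  shows "H_int g J W i q p =
           (1/2) * (\<Sum>a\<in>UNIV. \<Sum>b\<in>UNIV.
              raise_index (g q) (A_coeff (J q) i) $ Inr a $ Inr b * p' $ Inr a * p' $ Inr b)
         + (1/2) * Delta_coeff (J q) i * (\<Sum>k\<in>UNIV. \<Sum>l\<in>UNIV.
              raise_index (g q) (J1 (J q)) $ Inl k $ Inl l * p' $ Inl k * p' $ Inl l)
         + W i q
       \<and> (\<forall>a b. raise_index (g q) (A_coeff (J q) i) $ Inr a $ Inr b =
              Delta_coeff (J q) (i + 1) * matrix_inv (g q) $ Inr a $ Inr b
            + (\<Sum>j = 1..CARD('n) - i. (- 1) ^ j * Delta_coeff (J q) (j + i + 1) *
                (mat_power (Jbar2 (J q)) j ** xx_block (matrix_inv (g q))) $ a $ b))"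
proof (intro conjI allI)
  obtain k where k: "i = Suc k" "k < CARD('n)" using assms(3) by (cases i) auto
  define G where "G = matrix_inv (g q)"
  define A where "A = A_coeff (J q) i"
  have metric: "riemannian_metric U g" and scKt: "scKt U g J"
    and mixed: "\<And>i a. g q $ Inl i $ Inr a = 0 \<and> g q $ Inr a $ Inl i = 0"
    using assms(1,5) unfolding driven_cofactor_system_def cofactor_system_def by blast+
  have inv: "invertible (g q)"
    using metric assms(5) by (intro invertible_positive_definite) (simp add: riemannian_metric_def)
  note G = matrix_inv_left[OF inv, folded G_def] matrix_inv_right[OF inv, folded G_def]
  \<comment> \<open>Multiplying by \<open>G\<close> on both sides transfers relations from the
    metric to its inverse: once for the symmetry of \<open>g q ** J q\<close>, once for the absence
    of mixed terms.\<close>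
  have intertwine: "G ** M = N ** G" if "M ** g q = g q ** N" for M N
  proof -
    have "G ** M = G ** M ** (g q ** G)" by (simp add: G)
    also have "\<dots> = G ** (M ** g q) ** G" by (simp only: matrix_mul_assoc)
    also have "\<dots> = (G ** g q) ** N ** G" by (simp only: that matrix_mul_assoc)
    finally show ?thesis by (simp add: G)
  qed
  have "transpose (g q) = g q" "transpose (g q ** J q) = g q ** J q"
    using metric scKt assms(5) by (auto simp: riemannian_metric_def scKt_def)
  then have GJ: "G ** transpose (J q) = J q ** G"
    by (intro intertwine) (simp add: matrix_transpose_mul)
  have "(P1 ** g q) $ \<alpha> $ \<beta> = (g q ** P1) $ \<alpha> $ \<beta>" for \<alpha> \<beta>
    by (cases \<alpha>; cases \<beta>) (simp_all add: projector_mult_nth mixed)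
  then have GP: "G ** P1 = P1 ** G"
    by (intro intertwine) (simp add: vec_eq_iff)
  have G_mixed: "G $ Inl k $ Inr a = 0" for k a
    using arg_cong[OF GP, of "\<lambda>M. M $ Inl k $ Inr a"]
    by (simp add: projector_mult_nth)

  have "p = p' v* (P1 ** J q + P2)"
  proof -
    have vector_matrix_add: "p' v* (M + N) = p' v* M + p' v* N" for M N :: "real^('m + 'n)^('m + 'n)"
      by (simp add: vector_matrix_mult_def vec_eq_iff sum.distrib algebra_simps)
    have "p $ \<gamma> = (p' v* (P1 ** J q + P2)) $ \<gamma>" for \<gamma>
      using assms(6,7)
      by (cases \<gamma>) (simp_all add: vector_matrix_mult_def[of p' "P1 ** _"] sum_UNIV_sum projector_mult_nth
          vector_matrix_add mult.commute)
    then show ?thesis by (simp add: vec_eq_iff)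
  qed
  then have "p \<bullet> ((A ** G) *v p)
      = p' \<bullet> ((Delta_coeff (J q) i *\<^sub>R (P1 ** J q ** P1 ** G) + P2 ** (A ** G) ** P2) *v p')"
    unfolding A_def k(1) momentum_change_block_diagonal[OF GJ GP, symmetric]
    by (simp add: quadratic_form_vector_matrix_mult)
  \<comment> \<open>With \<open>P1\<close> outermost on both sides, only the entries with two y
    indices survive in the quadratic form.\<close>
  moreover have "P1 ** J q ** P1 ** G = P1 ** (J q ** G) ** P1"
    by (simp only: GP flip: matrix_mul_assoc)
  ultimately have "(\<Sum>\<alpha>\<in>UNIV. \<Sum>\<beta>\<in>UNIV. (A ** G) $ \<alpha> $ \<beta> * p $ \<alpha> * p $ \<beta>)
      = (\<Sum>a\<in>UNIV. \<Sum>b\<in>UNIV. (A ** G) $ Inr a $ Inr b * p' $ Inr a * p' $ Inr b)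
      + Delta_coeff (J q) i *
        (\<Sum>k\<in>UNIV. \<Sum>l\<in>UNIV. (P1 ** J q ** P1 ** G) $ Inl k $ Inl l * p' $ Inl k * p' $ Inl l)"
    unfolding quadratic_form_eq_inner[of "A ** G"]
    by (simp add: quadratic_form_eq_inner[symmetric] sum_UNIV_sum projector_mult_nth sum_distrib_left mult.assoc)
  then show "H_int g J W i q p =
           (1/2) * (\<Sum>a\<in>UNIV. \<Sum>b\<in>UNIV.
              raise_index (g q) (A_coeff (J q) i) $ Inr a $ Inr b * p' $ Inr a * p' $ Inr b)
         + (1/2) * Delta_coeff (J q) i * (\<Sum>k\<in>UNIV. \<Sum>l\<in>UNIV.
              raise_index (g q) (J1 (J q)) $ Inl k $ Inl l * p' $ Inl k * p' $ Inl l)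
         + W i q"
    by (simp add: H_int_def raise_index_def J1_def A_def G_def algebra_simps)

  fix a b
  \<comment> \<open>As \<open>G\<close> has no mixed entries, raising the index acts on the x-block
    alone.\<close>
  have "raise_index (g q) A $ Inr a $ Inr b = (xx_block A ** xx_block G) $ a $ b"
    by (simp add: raise_index_def xx_block_def matrix_matrix_mult_def sum_UNIV_sum G_mixed flip: G_def)
  also have "xx_block A = (\<Sum>j\<le>CARD('n) - i.
      ((- 1) ^ j * Delta_coeff (J q) (j + i + 1)) *\<^sub>R mat_power (Jbar2 (J q)) j)"
    using xx_block_A_coeff[of "J q" k] k assms(2,5) by (simp add: A_def)
  also have "(\<dots> ** xx_block G) $ a $ b = (\<Sum>j\<le>CARD('n) - i. (- 1) ^ j * Delta_coeff (J q) (j + i + 1) *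
      (mat_power (Jbar2 (J q)) j ** xx_block G) $ a $ b)"
    unfolding matrix_matrix_mult_def
    by (simp add: sum_component sum_distrib_left sum_distrib_right mult.assoc, rule sum.swap)
  \<comment> \<open>The term j = 0 has the identity as its matrix power and gives the separate
    metric term; for i = n nothing else remains.\<close>
  also have "\<dots> = Delta_coeff (J q) (i + 1) * G $ Inr a $ Inr b
      + (\<Sum>j = 1..CARD('n) - i. (- 1) ^ j * Delta_coeff (J q) (j + i + 1) *
          (mat_power (Jbar2 (J q)) j ** xx_block G) $ a $ b)"
    by (simp add: atMost_atLeast0 sum.atLeast_Suc_atMost) (simp add: xx_block_def)
  finally show "raise_index (g q) (A_coeff (J q) i) $ Inr a $ Inr b =
              Delta_coeff (J q) (i + 1) * matrix_inv (g q) $ Inr a $ Inr b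
            + (\<Sum>j = 1..CARD('n) - i. (- 1) ^ j * Delta_coeff (J q) (j + i + 1) *
                (mat_power (Jbar2 (J q)) j ** xx_block (matrix_inv (g q))) $ a $ b)"
    by (simp add: A_def G_def)
qed

end
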